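(* Let $p$ be a prime number, $\alpha$ a positive integer, $P(n)$ a polynomial with integer coefficients, and let $(C_i)_{1\le i\le r}$, $(D_i)_{1\le i\le s}$, $(E_i)_{1\le i\le t}$, $(F_i)_{1\le i\le t}$ be integer sequences with $C_i>0$, $D_i>0$, $p\nmid\gcd(E_i,F_i)$ for all $i$, $\sum_{i=1}^rC_i=\sum_{i=1}^sD_i$, and $\{C_i:1\le i\le r\}\ne\{D_i:1\le i\le s\}$. Define \[ S(n):=\frac{P(n)}{\prod_{i=1}^t(E_in+F_i)}\cdot\frac{\prod_{i=1}^r(C_in)!}{\prod_{i=1}^s(D_in)!},\qquad n\ge0. \] If all elements of the sequence $(S(n))_{n\ge0}$ are integers, then \[ \lim_{N\to\infty}\frac1N\#\{0\le n<N:\ S(n)\equiv0 \pmod{p^\alpha}\}=1. \] *)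

theory Defs
  imports Complex_Main "HOL-Computational_Algebra.Polynomial" "HOL-Computational_Algebra.Primes"
    "HOL-Number_Theory.Cong"
begin

text \<open>The families are indexed by \<open>1..r\<close>, \<open>1..s\<close>, \<open>1..t\<close>; values outside these ranges are irrelevant.
  The conversion \<open>nat\<close> is harmless where \<open>C i > 0\<close> and \<open>D i > 0\<close>, and the quotient is meaningful
  only where no factor \<open>E i * n + F i\<close> vanishes.\<close>

definition S_seq ::
  "int poly \<Rightarrow> nat \<Rightarrow> (nat \<Rightarrow> int) \<Rightarrow> nat \<Rightarrow> (nat \<Rightarrow> int) \<Rightarrow>
   nat \<Rightarrow> (nat \<Rightarrow> int) \<Rightarrow> (nat \<Rightarrow> int) \<Rightarrow> nat \<Rightarrow> rat" where
  "S_seq P r C s D t E F n =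
     of_int (poly P (int n)) / of_int (\<Prod>i = 1..t. E i * int n + F i) *
     ((\<Prod>i = 1..r. fact (nat (C i * int n))) / (\<Prod>i = 1..s. fact (nat (D i * int n))))"

end

theory Submission
  imports Defs
begin

text \<open>
  By Legendre's formula the \<open>p\<close>-adic valuation of the factorial ratio at \<open>n\<close> is \<open>\<Sum>l\<ge>1. g (n / p ^ l)\<close>
  for the 1-periodic step function \<open>g x = \<Sum>\<lfloor>C\<^sub>i x\<rfloor> - \<Sum>\<lfloor>D\<^sub>i x\<rfloor>\<close>. Integrality of all \<open>S n\<close>, tested at
  large primes, forces \<open>g \<ge> 0\<close>, and \<open>{C\<^sub>i} \<noteq> {D\<^sub>i}\<close> forces \<open>g \<ge> 1\<close> on some interval, hence on an
  interval between consecutive multiples of \<open>1 / p ^ k\<close>. So the valuation is at least the number of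
  times a certain digit occurs in the base \<open>p ^ k\<close> expansion of \<open>n\<close>, and the \<open>n\<close> for which this is
  bounded have density zero. The factors \<open>E\<^sub>i n + F\<^sub>i\<close> cost at most \<open>h\<close> each outside a set of
  density at most \<open>t / p ^ h\<close>.
\<close>

section \<open>Floors just above a rational point\<close>

text \<open>The number \<open>c * u / m\<close> lies at least \<open>1 / m\<close> below the next
  larger integer, and passing from \<open>u / m\<close> up to \<open>n / q\<close> raises
  \<open>c * x\<close> by less than that.\<close>

lemma div_eq_of_close_above:
  fixes c m n q u :: nat
  assumes "m > 0" "q > 0" "u * q \<le> n * m" "c * (n * m - u * q) < q"
  shows "c * n div q = c * u div m"
proof -
  define e where "e = n * m - u * q"
  have nm: "n * m = u * q + e" using assms(3) by (simp add: e_def)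
  define x where "x = c * u div m"
  define y where "y = c * u mod m"
  have cu: "c * u = m * x + y" by (simp add: x_def y_def)
  have ym: "y < m" using assms(1) by (simp add: y_def)
  have "c * n * m = (m * x + y) * q + c * e"
    using nm cu by (metis distrib_left mult.assoc)
  hence eq: "c * n * m = x * q * m + (y * q + c * e)" by (simp add: algebra_simps)
  have "y * q + c * e < y * q + q" using assms(4) by (simp add: e_def)
  also have "\<dots> = Suc y * q" by simp
  also have "\<dots> \<le> m * q" using ym by (intro mult_right_mono) auto
  finally have "c * n * m < x * q * m + m * q" using eq by simp
  also have "\<dots> = (x + 1) * q * m" by (simp add: algebra_simps)
  finally have "c * n < (x + 1) * q" by simp
  moreover have "x * q * m \<le> c * n * m" using eq by simp
  hence "x * q \<le> c * n" using assms(1) by simp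
  ultimately show ?thesis unfolding x_def[symmetric]
    by (metis Suc_eq_plus1 div_nat_eqI mult.commute)
qed

section \<open>Common divisors of consecutive polynomial values\<close>

lemma poly_shift_diff_nonzero:
  fixes P :: "int poly"
  assumes "degree P > 0"
  shows "pcompose P [:1, 1:] - P \<noteq> 0"
proof
  assume "pcompose P [:1, 1:] - P = 0"
  hence "poly (pcompose P [:1, 1:]) x = poly P x" for x by simp
  hence step: "poly P (1 + x) = poly P x" for x by (simp add: poly_pcompose)
  have "poly P (int n) = poly P 0" for n
    by (induction n) (simp_all only: of_nat_0 of_nat_Suc step)
  hence "range int \<subseteq> {x. poly (P - [:poly P 0:]) x = 0}" by auto
  moreover have "infinite (range int)"
    by (simp add: finite_image_iff)
  ultimately have "P - [:poly P 0:] = 0"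
    using poly_roots_finite finite_subset by blast
  hence "P = [:poly P 0:]" by simp
  hence "degree P = 0" by (metis degree_pCons_0)
  thus False using assms by simp
qed

lemma degree_poly_shift_diff_less:
  fixes P :: "int poly"
  assumes "degree P > 0"
  shows "degree (pcompose P [:1, 1:] - P) < degree P"
proof -
  let ?Q = "pcompose P [:1, 1:]"
  have d: "degree ?Q = degree P" by (simp add: degree_pcompose)
  have "lead_coeff ?Q = lead_coeff P" by (subst lead_coeff_comp) auto
  hence "coeff (?Q - P) (degree P) = 0" using d by simp
  moreover have "degree (?Q - P) \<le> degree P" using d by (metis degree_diff_le order_refl)
  moreover have "?Q - P \<noteq> 0" using poly_shift_diff_nonzero[OF assms] .
  ultimately show ?thesis
    by (metis leading_coeff_0_iff order_le_less)
qed

text \<open>A forward difference lowers the degree and uses up at least one value, so the induction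
  ends at a nonzero constant. Since \<open>M\<close> depends on \<open>P\<close> alone, a prime
  larger than \<open>M\<close> can be fixed before the position \<open>a\<close>.\<close>

lemma common_divisor_consecutive_poly_values:
  fixes P :: "int poly"
  assumes "P \<noteq> 0"
  shows "\<exists>M > 0. \<forall>m a. (\<forall>j \<le> degree P. m dvd poly P (a + int j)) \<longrightarrow> m dvd M"
  using assms
proof (induction "degree P" arbitrary: P rule: less_induct)
  case less
  show ?case
  proof (cases "degree P = 0")
    case True
    then obtain c where "P = [:c:]" using degree_eq_zeroE by blast
    with less.prems show ?thesis by (intro exI[of _ "\<bar>c\<bar>"]) auto
  next
    case False
    define Q where "Q = pcompose P [:1, 1:] - P"
    have Q: "degree Q < degree P" "Q \<noteq> 0"
      using False poly_shift_diff_nonzero degree_poly_shift_diff_less by (auto simp: Q_def)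
    obtain M where M: "M > 0" "\<And>m a. \<forall>j \<le> degree Q. m dvd poly Q (a + int j) \<Longrightarrow> m dvd M"
      using less.hyps[OF Q] by blast
    have "m dvd M" if *: "\<forall>j \<le> degree P. m dvd poly P (a + int j)" for m a
    proof (rule M(2), intro allI impI)
      fix j assume j: "j \<le> degree Q"
      have "m dvd poly P (a + int (Suc j))" "m dvd poly P (a + int j)"
        using * j Q(1) by (simp_all del: of_nat_Suc)
      moreover have "poly Q (a + int j) = poly P (a + int (Suc j)) - poly P (a + int j)"
        by (simp add: Q_def poly_pcompose algebra_simps)
      ultimately show "m dvd poly Q (a + int j)" by simp
    qed
    with M(1) show ?thesis by blast
  qed
qed

section \<open>Legendre's formula\<close>

lemma multiplicity_int_eq_sum_dvd:
  fixes q m L :: nat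
  assumes "prime q" "0 < m" "m < q ^ Suc L"
  shows "multiplicity (int q) (int m) = (\<Sum>l = 1..L. of_bool (q ^ l dvd m))"
proof -
  define v where "v = multiplicity (int q) (int m)"
  have nu: "\<not> is_unit (int q)" using assms(1) prime_gt_1_nat[OF assms(1)] by simp
  have iff: "q ^ l dvd m \<longleftrightarrow> l \<le> v" for l
  proof -
    have "q ^ l dvd m \<longleftrightarrow> int q ^ l dvd int m" by (metis of_nat_dvd_iff of_nat_power)
    also have "\<dots> \<longleftrightarrow> l \<le> v"
      unfolding v_def using nu assms(2) by (intro power_dvd_iff_le_multiplicity) auto
    finally show ?thesis .
  qed
  have "\<not> q ^ Suc L dvd m" using assms(2,3) by (meson dvd_imp_le not_less)
  hence vL: "v \<le> L" using iff by (metis not_less_eq_eq)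
  have "(\<Sum>l = 1..L. of_bool (q ^ l dvd m)) = card ({1..L} \<inter> {l. q ^ l dvd m})"
    by (simp add: of_bool_def sum.If_cases)
  also have "{1..L} \<inter> {l. q ^ l dvd m} = {1..v}" unfolding iff using vL by auto
  finally show ?thesis by (simp add: v_def)
qed

text \<open>Induction on \<open>n\<close>: the term for \<open>l\<close> grows by one exactly when
  \<open>q ^ l\<close> divides \<open>Suc n\<close>. Any large enough cut-off \<open>L\<close> is
  allowed, so several factorials can share one.\<close>

lemma multiplicity_fact_int:
  fixes q n L :: nat
  assumes "prime q" "n < q ^ Suc L"
  shows "multiplicity (int q) (fact n) = (\<Sum>l = 1..L. n div q ^ l)"
  using assms(2)
proof (induction n)
  case (Suc n)
  have pe: "prime_elem (int q)" using assms(1) by simp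
  have "multiplicity (int q) (fact (Suc n)) = multiplicity (int q) (int (Suc n) * fact n)"
    by simp
  also have "\<dots> = multiplicity (int q) (int (Suc n)) + multiplicity (int q) (fact n)"
    by (rule prime_elem_multiplicity_mult_distrib[OF pe]) auto
  also have "\<dots> = (\<Sum>l = 1..L. of_bool (q ^ l dvd Suc n)) + (\<Sum>l = 1..L. n div q ^ l)"
    using Suc multiplicity_int_eq_sum_dvd[OF assms(1), of "Suc n" L] by simp
  also have "\<dots> = (\<Sum>l = 1..L. Suc n div q ^ l)"
    unfolding sum.distrib[symmetric]
    by (intro sum.cong refl) (auto simp: div_Suc dvd_eq_mod_eq_0)
  finally show ?case .
qed auto

section \<open>Periodic conditions and digit counts\<close>

text \<open>Cuts \<open>{..<N}\<close> into blocks of length \<open>m\<close>, the last one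
  incomplete. This turns a count over one period into a bound linear in \<open>N\<close>.\<close>

lemma card_periodic_le:
  fixes T :: "nat \<Rightarrow> bool"
  assumes "m > 0" "\<And>n. T n \<Longrightarrow> T (n mod m)"
  shows "card {n. n < N \<and> T n} \<le> (N div m + 1) * card {n. n < m \<and> T n}"
proof -
  have "card {n. n < N \<and> T n} \<le> card ({..N div m} \<times> {n. n < m \<and> T n})"
  proof (rule card_inj_on_le)
    show "inj_on (\<lambda>n. (n div m, n mod m)) {n. n < N \<and> T n}"
      by (intro inj_onI) (metis div_mult_mod_eq prod.inject)
    show "(\<lambda>n. (n div m, n mod m)) ` {n. n < N \<and> T n} \<subseteq> {..N div m} \<times> {n. n < m \<and> T n}"
      using assms by (auto intro: div_le_mono)
  qed auto
  thus ?thesis by (simp add: card_cartesian_product)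
qed

text \<open>Only the \<open>L\<close> lowest digits are read, padding zeros included, so the count
  has period \<open>B ^ L\<close> in \<open>n\<close>.\<close>

definition digit_count :: "nat \<Rightarrow> nat \<Rightarrow> nat \<Rightarrow> nat \<Rightarrow> nat" where
  "digit_count B a L n = (\<Sum>j<L. of_bool (n div B ^ j mod B = a))"

lemma digit_count_Suc:
  "digit_count B a (Suc L) n = of_bool (n mod B = a) + digit_count B a L (n div B)"
proof -
  have "n div B ^ Suc j = n div B div B ^ j" for j
    by (simp only: power_Suc div_mult2_eq)
  thus ?thesis unfolding digit_count_def sum.lessThan_Suc_shift by simp
qed

lemma digit_count_mod:
  assumes "B > 0"
  shows "digit_count B a L (n mod B ^ L) = digit_count B a L n"
proof -
  have "(n mod B ^ L) div B ^ j mod B = n div B ^ j mod B" if jL: "j < L" for j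
  proof -
    obtain i where i: "L = Suc (j + i)" using less_imp_Suc_add[OF jL] by auto
    have "n mod B ^ L = n mod (B ^ j * B ^ Suc i)" by (simp only: i power_Suc power_add mult.left_commute)
    also have "\<dots> = B ^ j * (n div B ^ j mod B ^ Suc i) + n mod B ^ j"
      by (rule mod_mult2_eq)
    finally have "(n mod B ^ L) div B ^ j = n div B ^ j mod B ^ Suc i"
      using assms by simp
    thus ?thesis by (simp add: mod_mod_cancel)
  qed
  thus ?thesis unfolding digit_count_def by (intro sum.cong) auto
qed

text \<open>The weight is a product over \<open>L\<close> independent digits; each place contributes
  \<open>B - 1\<close> digits of weight 1 and the digit \<open>a\<close> of weight 1/2.\<close>

lemma sum_half_power_digit_count:
  assumes "a < B"
  shows "(\<Sum>n < B ^ L. (1 / 2 :: real) ^ digit_count B a L n) = (real B - 1 / 2) ^ L"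
proof (induction L)
  case 0
  thus ?case by (simp add: digit_count_def)
next
  case (Suc L)
  let ?w = "\<lambda>L n. (1 / 2 :: real) ^ digit_count B a L n"
  let ?v = "\<lambda>d. (1 / 2 :: real) ^ of_bool (d = a)"
  have "(\<Sum>n < B ^ Suc L. ?w (Suc L) n) = (\<Sum>(m, d) \<in> {..<B ^ L} \<times> {..<B}. ?w L m * ?v d)"
  proof (rule sum.reindex_bij_witness[where j = "\<lambda>n. (n div B, n mod B)"
        and i = "\<lambda>(m, d). m * B + d"])
    fix n assume "n \<in> {..<B ^ Suc L}"
    thus "(n div B, n mod B) \<in> {..<B ^ L} \<times> {..<B}"
      using assms by (auto simp: less_mult_imp_div_less mult.commute)
  next
    fix x assume x: "x \<in> {..<B ^ L} \<times> {..<B}"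
    obtain m d where [simp]: "x = (m, d)" by force
    have "m * B + d < m * B + B" using x by simp
    also have "\<dots> = Suc m * B" by simp
    also have "\<dots> \<le> B ^ L * B" using x by (intro mult_right_mono) auto
    finally show "(case x of (m, d) \<Rightarrow> m * B + d) \<in> {..<B ^ Suc L}" by (simp add: mult.commute)
  qed (use assms in \<open>auto simp: digit_count_Suc power_add\<close>)
  also have "\<dots> = (\<Sum>m < B ^ L. ?w L m) * (\<Sum>d < B. ?v d)"
    by (simp add: sum_product sum.cartesian_product)
  also have "(\<Sum>d < B. ?v d) = real B - 1 / 2"
  proof -
    have "(\<Sum>d < B. ?v d) = ?v a + (\<Sum>d \<in> {..<B} - {a}. ?v d)"
      using assms by (intro sum.remove) auto
    also have "(\<Sum>d \<in> {..<B} - {a}. ?v d) = (\<Sum>d \<in> {..<B} - {a}. 1)"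
      by (intro sum.cong) auto
    finally show ?thesis using assms by (simp add: of_nat_diff)
  qed
  finally show ?case using Suc by simp
qed

text \<open>Markov's inequality for \<open>2 ^ (- digit_count)\<close>.\<close>

lemma card_digit_count_less:
  assumes "a < B"
  shows "real (card {n. n < B ^ L \<and> digit_count B a L n < K}) \<le> 2 ^ K * (real B - 1 / 2) ^ L"
proof -
  let ?w = "\<lambda>n. (1 / 2 :: real) ^ digit_count B a L n"
  let ?A = "{n. n < B ^ L \<and> digit_count B a L n < K}"
  have "(1 / 2) ^ K * real (card ?A) = (\<Sum>n \<in> ?A. (1 / 2 :: real) ^ K)" by simp
  also have "\<dots> \<le> (\<Sum>n \<in> ?A. ?w n)" by (intro sum_mono power_decreasing) auto
  also have "\<dots> \<le> (\<Sum>n < B ^ L. ?w n)" by (intro sum_mono2) auto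
  also have "\<dots> = (real B - 1 / 2) ^ L" by (rule sum_half_power_digit_count[OF assms])
  finally show ?thesis by (simp add: field_simps)
qed

section \<open>Linear factors divisible by a high power of \<open>p\<close>\<close>

text \<open>Once a solution exists, \<open>p\<close> cannot divide \<open>E\<close>, since it would
  then divide \<open>F\<close> too. So \<open>E\<close> is invertible modulo \<open>p ^ h\<close>,
  and the solutions form one residue class.\<close>

lemma card_dvd_linear_le:
  fixes E F :: int
  assumes "prime p" "\<not> int p dvd gcd E F" "h > 0"
  shows "card {n. n < N \<and> int p ^ h dvd E * int n + F} \<le> N div p ^ h + 1"
proof -
  let ?T = "\<lambda>n. int p ^ h dvd E * int n + F"
  have p0: "p ^ h > 0" using assms(1) by (simp add: prime_gt_0_nat)
  have "?T (n mod p ^ h)" if "?T n" for n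
  proof -
    have "[E * int (n mod p ^ h) + F = E * int n + F] (mod int p ^ h)"
      by (intro cong_add cong_mult cong_refl) (simp add: zmod_int cong_def)
    thus ?thesis using that by (simp add: cong_dvd_iff)
  qed
  hence "card {n. n < N \<and> ?T n} \<le> (N div p ^ h + 1) * card {n. n < p ^ h \<and> ?T n}"
    using p0 by (intro card_periodic_le)
  moreover have "card {n. n < p ^ h \<and> ?T n} \<le> Suc 0"
  proof (intro card_le_Suc0_iff_eq[THEN iffD2] ballI, simp)
    fix x y assume "x \<in> {n. n < p ^ h \<and> ?T n}" "y \<in> {n. n < p ^ h \<and> ?T n}"
    hence x: "x < p ^ h" "?T x" and y: "y < p ^ h" "?T y" by auto
    have "int p dvd int p ^ h" using assms(3) by (simp add: dvd_power)
    hence pd: "int p dvd E * int x + F" using x(2) dvd_trans by blast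
    have "\<not> int p dvd E"
    proof
      assume "int p dvd E"
      hence "int p dvd F" using pd by (meson dvd_add_right_iff dvd_mult2)
      thus False using \<open>int p dvd E\<close> assms(2) by simp
    qed
    hence "coprime E (int p ^ h)" using assms(1)
      by (metis coprime_commute coprime_power_right_iff prime_imp_coprime prime_nat_int_transfer)
    moreover have "int p ^ h dvd E * (int x - int y)"
      using dvd_diff[OF x(2) y(2)] by (simp add: algebra_simps)
    ultimately have "int p ^ h dvd int x - int y"
      by (metis coprime_commute coprime_dvd_mult_right_iff)
    hence "[int x = int y] (mod int (p ^ h))" by (simp add: cong_iff_dvd_diff)
    hence "[x = y] (mod p ^ h)" by (simp only: cong_int_iff)
    thus "x = y" using x(1) y(1) by (simp add: cong_def)
  qed
  hence "(N div p ^ h + 1) * card {n. n < p ^ h \<and> ?T n} \<le> (N div p ^ h + 1) * Suc 0"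
    by (rule mult_le_mono2)
  ultimately show ?thesis by simp
qed

section \<open>Density from linear bounds\<close>

lemma density_zero_of_linear_bounds:
  fixes f :: "nat \<Rightarrow> nat"
  assumes "\<And>e. e > 0 \<Longrightarrow> \<exists>c. \<forall>N. real (f N) \<le> e * real N + c"
  shows "(\<lambda>N. real (f N) / real N) \<longlonglongrightarrow> 0"
proof (rule LIMSEQ_I)
  fix e :: real assume e: "e > 0"
  obtain c where c: "\<And>N. real (f N) \<le> e / 2 * real N + c" using assms[of "e / 2"] e by auto
  obtain N0 where N0: "real N0 > 2 * c / e" using reals_Archimedean2 by blast
  show "\<exists>no. \<forall>n\<ge>no. norm (real (f n) / real n - 0) < e"
  proof (intro exI allI impI)
    fix N assume N: "N \<ge> Suc N0"
    have "2 * c / e < real N" using N0 N by linarith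
    hence "c < e / 2 * real N" using e by (simp add: field_simps)
    hence "real (f N) < e * real N" using c[of N] by (simp add: field_simps)
    thus "norm (real (f N) / real N - 0) < e" using N by (simp add: field_simps)
  qed
qed

section \<open>Jumps of floors and counts of multiples\<close>

text \<open>Compares the floor of \<open>c * x\<close> at \<open>x = 1 / M\<close>, expanded by
  \<open>Suc k\<close>, with its value one step to the left. The fractional part of
  \<open>c / M\<close> is 0 or at least \<open>1 / M\<close>, and by \<open>c \<le> k\<close> the
  step lowers \<open>c * x\<close> by less than \<open>1 / M\<close>, so only a jump at
  \<open>1 / M\<close> itself is seen.\<close>

lemma div_jump_at_inverse:
  fixes c M k :: nat
  assumes "c > 0" "M > 0" "c \<le> k"
  shows "c * Suc k div (M * Suc k) = c * k div (M * Suc k) + of_bool (M dvd c)"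
proof -
  have 1: "c * Suc k div (M * Suc k) = c div M" by (rule div_mult_mult2) simp
  define x where "x = c div M"
  define e where "e = c mod M"
  have c: "c = M * x + e" by (simp add: x_def e_def)
  show ?thesis
  proof (cases "M dvd c")
    case True
    hence "e = 0" by (simp add: e_def)
    with c assms(1) obtain y where y: "x = Suc y" by (cases x) auto
    have cy: "c = M * Suc y" using c \<open>e = 0\<close> y by simp
    have "Suc y \<le> c" unfolding cy using assms(2) by (cases M) (auto simp del: mult_Suc_right)
    hence "y \<le> k" using assms(3) by simp
    have "c * k div (M * Suc k) = y"
    proof (rule div_nat_eqI)
      have "y * Suc k \<le> Suc y * k" using \<open>y \<le> k\<close> by simp
      hence "M * (y * Suc k) \<le> M * (Suc y * k)" by (rule mult_le_mono2)
      thus "M * Suc k * y \<le> c * k" by (simp only: cy mult_ac)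
      have "Suc y * k < Suc y * Suc k" by simp
      hence "M * (Suc y * k) < M * (Suc y * Suc k)" using assms(2) mult_less_mono2 by blast
      thus "c * k < M * Suc k * Suc y" by (simp only: cy mult_ac)
    qed
    thus ?thesis using 1 True y by (simp add: x_def)
  next
    case False
    hence "e > 0" using assms(2) by (simp add: e_def mod_greater_zero_iff_not_dvd)
    have "c * k div (M * Suc k) = x"
    proof (rule div_nat_eqI)
      have "M * x \<le> k" using c assms(3) by simp
      also have "k \<le> e * k" using \<open>e > 0\<close> by simp
      finally show "M * Suc k * x \<le> c * k" by (simp add: c algebra_simps)
      have "e < M" using assms(2) by (simp add: e_def)
      hence "c < M * Suc x" using c by simp
      have "c * k \<le> c * Suc k" by simp
      also have "\<dots> < M * Suc x * Suc k" using \<open>c < M * Suc x\<close> by (rule mult_less_mono1) simp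
      finally show "c * k < M * Suc k * Suc x" by (simp only: mult_ac)
    qed
    thus ?thesis using 1 False by (simp add: x_def)
  qed
qed

lemma card_dvd_eq_sum_card_eq:
  fixes c :: "'a \<Rightarrow> nat"
  assumes "finite I" "\<And>i. i \<in> I \<Longrightarrow> 0 < c i \<and> c i \<le> N"
  shows "card {i \<in> I. k dvd c i} =
    card {i \<in> I. c i = k} + (\<Sum>l | k < l \<and> l \<le> N \<and> k dvd l. card {i \<in> I. c i = l})"
proof -
  let ?S = "{i \<in> I. k dvd c i}" and ?K = "{l. k < l \<and> l \<le> N \<and> k dvd l}"
  have "card ?S = (\<Sum>l \<in> insert k ?K. \<Sum>i \<in> {i \<in> ?S. c i = l}. 1)"
  proof (subst sum.group)
    show "c ` ?S \<subseteq> insert k ?K"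
      using assms(2) dvd_imp_le by (fastforce simp: order_le_less)
  qed (use assms(1) in auto)
  also have "\<dots> = (\<Sum>l \<in> insert k ?K. card {i \<in> I. c i = l})"
    by (intro sum.cong refl) (auto intro: arg_cong[where f = card])
  finally show ?thesis by simp
qed

text \<open>Downward induction on \<open>k\<close>: subtracting the counts at the larger multiples
  of \<open>k\<close>, already known to agree, from the number of multiples leaves the count at
  \<open>k\<close>.\<close>

lemma card_eq_of_card_dvd_eq:
  fixes c :: "'a \<Rightarrow> nat" and d :: "'b \<Rightarrow> nat"
  assumes "finite I" "\<And>i. i \<in> I \<Longrightarrow> 0 < c i \<and> c i \<le> N"
    and "finite J" "\<And>i. i \<in> J \<Longrightarrow> 0 < d i \<and> d i \<le> N"
    and "\<And>k. k > 0 \<Longrightarrow> card {i \<in> I. k dvd c i} = card {i \<in> J. k dvd d i}"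
    and "k > 0"
  shows "card {i \<in> I. c i = k} = card {i \<in> J. d i = k}"
  using assms(6)
proof (induction "N - k" arbitrary: k rule: less_induct)
  case less
  have "(\<Sum>l | k < l \<and> l \<le> N \<and> k dvd l. card {i \<in> I. c i = l}) =
        (\<Sum>l | k < l \<and> l \<le> N \<and> k dvd l. card {i \<in> J. d i = l})"
    by (intro sum.cong refl less.hyps) auto
  thus ?case
    using assms(5)[OF less.prems] card_dvd_eq_sum_card_eq[OF assms(1,2), where k = k]
      card_dvd_eq_sum_card_eq[OF assms(3,4), where k = k] by simp
qed

section \<open>The step function of a factorial ratio\<close>

locale factorial_ratio =
  fixes I :: "'a set" and c :: "'a \<Rightarrow> nat" and J :: "'b set" and d :: "'b \<Rightarrow> nat"
  assumes finite_I: "finite I" and finite_J: "finite J"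
    and c_pos: "i \<in> I \<Longrightarrow> c i > 0" and d_pos: "j \<in> J \<Longrightarrow> d j > 0"
    and sum_eq: "(\<Sum>i\<in>I. c i) = (\<Sum>j\<in>J. d j)"
begin

text \<open>\<open>floor_diff n m\<close> is the value \<open>g (n / m)\<close> of the step function \<open>g\<close> above.\<close>

definition floor_diff :: "nat \<Rightarrow> nat \<Rightarrow> int" where
  "floor_diff n m = (\<Sum>i\<in>I. int (c i * n div m)) - (\<Sum>j\<in>J. int (d j * n div m))"

text \<open>Bounds every \<open>c i\<close> and every \<open>d j\<close>, so that one closeness
  condition or one cut-off serves all terms.\<close>

definition coeff_sum :: nat where
  "coeff_sum = (\<Sum>i\<in>I. c i)"

lemma c_le_coeff_sum: "i \<in> I \<Longrightarrow> c i \<le> coeff_sum"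
  unfolding coeff_sum_def using finite_I by (intro member_le_sum) auto

lemma d_le_coeff_sum: "j \<in> J \<Longrightarrow> d j \<le> coeff_sum"
  unfolding coeff_sum_def sum_eq using finite_J by (intro member_le_sum) auto

text \<open>Periodicity of \<open>g\<close>: dropping the integer part of \<open>n / m\<close>
  changes both sums by the same amount, by \<open>sum_eq\<close>.\<close>

lemma floor_diff_mod:
  assumes "m > 0"
  shows "floor_diff (n mod m) m = floor_diff n m"
proof -
  have *: "int (e * n div m) = int (e * (n mod m) div m) + int e * int (n div m)" for e
  proof -
    have "e * n = e * (m * (n div m) + n mod m)" by simp
    also have "\<dots> = e * (n mod m) + m * (e * (n div m))"
      by (simp only: distrib_left mult_ac add.commute)
    finally have "e * n div m = e * (n mod m) div m + e * (n div m)" using assms by simp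
    thus ?thesis by simp
  qed
  have "(\<Sum>i\<in>I. int (c i)) = (\<Sum>j\<in>J. int (d j))"
    using sum_eq by (simp only: of_nat_sum[symmetric])
  thus ?thesis unfolding floor_diff_def *[of _] sum.distrib sum_distrib_right[symmetric] by simp
qed

lemma floor_diff_close_above:
  assumes "m > 0" "q > 0" "u * q \<le> n * m" "coeff_sum * (n * m - u * q) < q"
  shows "floor_diff n q = floor_diff u m"
proof -
  have "e * n div q = e * u div m" if "e \<le> coeff_sum" for e
  proof (rule div_eq_of_close_above[OF assms(1-3)])
    have "e * (n * m - u * q) \<le> coeff_sum * (n * m - u * q)" using that by (rule mult_le_mono1)
    thus "e * (n * m - u * q) < q" using assms(4) by linarith
  qed
  thus ?thesis unfolding floor_diff_def using c_le_coeff_sum d_le_coeff_sum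
    by (auto intro!: arg_cong2[where f = minus] sum.cong)
qed

lemma multiplicity_ratio:
  assumes q: "prime q" and L: "coeff_sum * n < q ^ Suc L"
  shows "int (multiplicity (int q) (\<Prod>i\<in>I. fact (c i * n))) -
         int (multiplicity (int q) (\<Prod>j\<in>J. fact (d j * n))) = (\<Sum>l = 1..L. floor_diff n (q ^ l))"
proof -
  have pe: "prime_elem (int q)" using q by simp
  have *: "multiplicity (int q) (fact (e * n)) = (\<Sum>l = 1..L. e * n div q ^ l)" if "e \<le> coeff_sum" for e
  proof (rule multiplicity_fact_int[OF q])
    have "e * n \<le> coeff_sum * n" using that by simp
    thus "e * n < q ^ Suc L" using L by linarith
  qed
  have "multiplicity (int q) (\<Prod>i\<in>I. fact (c i * n)) = (\<Sum>i\<in>I. \<Sum>l = 1..L. c i * n div q ^ l)"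
    using finite_I pe by (subst prime_elem_multiplicity_prod_distrib) (auto simp: * c_le_coeff_sum)
  moreover have "multiplicity (int q) (\<Prod>j\<in>J. fact (d j * n)) = (\<Sum>j\<in>J. \<Sum>l = 1..L. d j * n div q ^ l)"
    using finite_J pe by (subst prime_elem_multiplicity_prod_distrib) (auto simp: * d_le_coeff_sum)
  ultimately show ?thesis
    by (simp only: floor_diff_def sum_subtractf of_nat_sum sum.swap[of _ "{1..L}"])
qed

text \<open>If \<open>g\<close> were negative at \<open>u / m\<close>, it would be negative at \<open>n / q\<close> for many consecutive \<open>n\<close> and
  a large prime \<open>q\<close>, where \<open>g (n / q)\<close> is the whole \<open>q\<close>-adic valuation of the factorial ratio; then
  \<open>q\<close> would divide more consecutive values of \<open>P\<close> than its degree permits.\<close>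

lemma floor_diff_nonneg:
  fixes P :: "int poly"
  assumes P: "P \<noteq> 0"
    and dvd: "\<And>n. (\<Prod>j\<in>J. fact (d j * n)) dvd poly P (int n) * (\<Prod>i\<in>I. fact (c i * n))"
    and m: "m > 0"
  shows "floor_diff u m \<ge> 0"
proof (rule ccontr)
  assume neg: "\<not> floor_diff u m \<ge> 0"
  obtain M where M: "M > 0"
    "\<And>k a. (\<forall>j \<le> degree P. k dvd poly P (a + int j)) \<Longrightarrow> k dvd M"
    using common_divisor_consecutive_poly_values[OF P] by blast
  let ?D = "degree P + 1"
  \<comment> \<open>The summands serve in turn to contradict \<open>q dvd M\<close>, to keep all
    \<open>?D\<close> points close enough to \<open>u / m\<close>, to get
    \<open>coeff_sum * n < q ^ 2\<close> so that only the term \<open>l = 1\<close> survives, and to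
    bound \<open>n\<close> by \<open>(u + 1) * q\<close>.\<close>
  obtain q where q: "prime q" "q > nat M + coeff_sum * (?D * m) + coeff_sum * (u + 1) + ?D"
    using bigger_prime by blast
  have q0: "q > 0" using q(2) by simp
  have pe: "prime_elem (int q)" using q(1) by simp
  \<comment> \<open>The least \<open>n\<close> with \<open>n / q > u / m\<close>.\<close>
  define n0 where "n0 = u * q div m + 1"
  have "int q dvd poly P (int n0 + int j)" if j: "j \<le> degree P" for j
  proof (cases "poly P (int n0 + int j) = 0")
    case False
    define n where "n = n0 + j"
    have n: "int n = int n0 + int j" by (simp add: n_def)
    have uq: "u * q = m * (u * q div m) + u * q mod m" by simp
    have modlt: "u * q mod m < m" using m by simp
    have nm: "n * m = m * (u * q div m) + m * (1 + j)" by (simp add: n_def n0_def algebra_simps)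
    have "m \<le> m * (1 + j)" by simp
    hence lo: "u * q \<le> n * m" using uq modlt nm by linarith
    have "n * m - u * q \<le> m * (1 + j)" using uq nm by linarith
    also have "\<dots> \<le> m * ?D" using j by (intro mult_le_mono2) simp
    finally have "coeff_sum * (n * m - u * q) \<le> coeff_sum * (?D * m)" by (simp add: mult.commute)
    hence eq: "floor_diff n q = floor_diff u m"
      using q(2) m q0 lo by (intro floor_diff_close_above) linarith+
    have "u * q div m \<le> u * q" by simp
    hence "n \<le> u * q + ?D" using j unfolding n_def n0_def by linarith
    also have "\<dots> \<le> u * q + q" using q(2) by linarith
    also have "\<dots> = (u + 1) * q" by simp
    finally have "coeff_sum * n \<le> coeff_sum * (u + 1) * q" by (metis mult.assoc mult_le_mono2)
    also have "\<dots> < q * q" using q(2) q0 by (intro mult_less_mono1) linarith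
    finally have "coeff_sum * n < q ^ Suc 1" by simp
    from multiplicity_ratio[OF q(1) this] eq neg
    have "multiplicity (int q) (\<Prod>i\<in>I. fact (c i * n)) < multiplicity (int q) (\<Prod>j\<in>J. fact (d j * n))"
      by simp
    also have "\<dots> \<le> multiplicity (int q) (poly P (int n) * (\<Prod>i\<in>I. fact (c i * n)))"
      using False n finite_I by (intro dvd_imp_multiplicity_le dvd) auto
    also have "\<dots> = multiplicity (int q) (poly P (int n)) + multiplicity (int q) (\<Prod>i\<in>I. fact (c i * n))"
      using False n finite_I by (intro prime_elem_multiplicity_mult_distrib[OF pe]) auto
    finally have "multiplicity (int q) (poly P (int n)) > 0" by simp
    thus ?thesis using n by (metis not_dvd_imp_multiplicity_0 less_irrefl)
  qed simp
  hence "int q dvd M" using M(2) by blast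
  hence "int q \<le> M" using M(1) zdvd_imp_le by blast
  thus False using q(2) by linarith
qed

text \<open>The jump of \<open>g\<close> at \<open>1 / k\<close> is the number of multiples of \<open>k\<close> among the \<open>c i\<close> minus that among
  the \<open>d j\<close>, and the numbers of multiples determine a multiset.\<close>

lemma floor_diff_not_identically_zero:
  assumes "c ` I \<noteq> d ` J"
  shows "\<exists>u m. m > 0 \<and> floor_diff u m \<noteq> 0"
proof (rule ccontr)
  assume "\<not> ?thesis"
  hence zero: "floor_diff u m = 0" if "m > 0" for u m using that by blast
  have dvd_eq: "card {i \<in> I. k dvd c i} = card {j \<in> J. k dvd d j}" if k: "k > 0" for k
  proof -
    \<comment> \<open>The point \<open>1 / k\<close> is expanded by \<open>Suc coeff_sum\<close>, so
      that one step to the left is short enough for every coefficient in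
      \<open>div_jump_at_inverse\<close>.\<close>
    have "(\<Sum>i\<in>I. int (c i * Suc coeff_sum div (k * Suc coeff_sum))) =
        (\<Sum>i\<in>I. int (c i * coeff_sum div (k * Suc coeff_sum))) + (\<Sum>i\<in>I. of_bool (k dvd c i))"
      unfolding sum.distrib[symmetric] using c_le_coeff_sum c_pos k
      by (intro sum.cong refl) (simp only: div_jump_at_inverse of_nat_add of_nat_of_bool)
    moreover have "(\<Sum>j\<in>J. int (d j * Suc coeff_sum div (k * Suc coeff_sum))) =
        (\<Sum>j\<in>J. int (d j * coeff_sum div (k * Suc coeff_sum))) + (\<Sum>j\<in>J. of_bool (k dvd d j))"
      unfolding sum.distrib[symmetric] using d_le_coeff_sum d_pos k
      by (intro sum.cong refl) (simp only: div_jump_at_inverse of_nat_add of_nat_of_bool)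
    moreover have "floor_diff (Suc coeff_sum) (k * Suc coeff_sum) = 0"
      "floor_diff coeff_sum (k * Suc coeff_sum) = 0" using k by (auto intro: zero)
    ultimately have "(\<Sum>i\<in>I. of_bool (k dvd c i)) = (\<Sum>j\<in>J. of_bool (k dvd d j) :: int)"
      unfolding floor_diff_def by linarith
    thus ?thesis using finite_I finite_J
      by (simp add: of_bool_def sum.If_cases Collect_conj_eq)
  qed
  have card_eq: "card {i \<in> I. c i = k} = card {j \<in> J. d j = k}" if "k > 0" for k
    using finite_I finite_J c_pos d_pos c_le_coeff_sum d_le_coeff_sum dvd_eq that
    by (intro card_eq_of_card_dvd_eq[where N = coeff_sum]) auto
  have iff: "k \<in> c ` I \<longleftrightarrow> k \<in> d ` J" if "k > 0" for k
  proof -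
    have "k \<in> c ` I \<longleftrightarrow> {i \<in> I. c i = k} \<noteq> {}" by auto
    also have "\<dots> \<longleftrightarrow> card {i \<in> I. c i = k} \<noteq> 0" using finite_I by simp
    also have "\<dots> \<longleftrightarrow> {j \<in> J. d j = k} \<noteq> {}" using card_eq[OF that] finite_J by simp
    also have "\<dots> \<longleftrightarrow> k \<in> d ` J" by auto
    finally show ?thesis .
  qed
  have "c ` I = d ` J"
    using iff c_pos d_pos by blast
  thus False using assms by simp
qed

text \<open>By right-continuity \<open>g\<close> is positive just to the right of
  \<open>u / m\<close>. For large \<open>B = p ^ k\<close> this stretch, reduced modulo 1, contains
  all of \<open>[a / B, (a + 1) / B)\<close>, where the fractional part of
  \<open>n / B ^ Suc j\<close> lies when digit \<open>j\<close> of \<open>n\<close> is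
  \<open>a\<close>.\<close>

lemma digit_forces_floor_diff_pos:
  assumes pos: "floor_diff u m > 0" "m > 0" and p: "p > 1"
  shows "\<exists>k a. k > 0 \<and> a < p ^ k \<and>
    (\<forall>n j. n div (p ^ k) ^ j mod p ^ k = a \<longrightarrow> floor_diff n ((p ^ k) ^ Suc j) > 0)"
proof -
  define v where "v = u mod m"
  have v: "v < m" "floor_diff v m > 0" using pos by (simp_all add: v_def floor_diff_mod)
  \<comment> \<open>The interval of \<open>a\<close> ends at most \<open>2 / B\<close> beyond
    \<open>v / m\<close>, which accounts for the factor 2; the closeness condition then follows from
    \<open>B > k\<close>.\<close>
  define k where "k = 2 * m * (coeff_sum + 1)"
  define B where "B = p ^ k"
  have k0: "k > 0" using pos(2) by (simp add: k_def)
  have Bk: "B > k" unfolding B_def using p by (intro power_gt_expt) simp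
  have B0: "B > 0" using Bk by simp
  \<comment> \<open>The least integer with \<open>a / B > v / m\<close>; it is a digit because
    \<open>v < m < B\<close>.\<close>
  define a where "a = v * B div m + 1"
  have vB: "v * B = m * (v * B div m) + v * B mod m" by simp
  have modlt: "v * B mod m < m" using pos(2) by simp
  have am: "a * m = m * (v * B div m) + m" by (simp add: a_def algebra_simps)
  have am_lo: "v * B \<le> a * m" and am_hi: "a * m \<le> v * B + m"
    using vB modlt am by linarith+
  have "m < B"
  proof -
    have "m * 1 \<le> m * (2 * (coeff_sum + 1))" by (intro mult_le_mono2) simp
    also have "\<dots> = k" by (simp add: k_def)
    finally show ?thesis using Bk by simp
  qed
  have "Suc v * B \<le> m * B" using v(1) by (intro mult_le_mono1) simp
  hence "a * m < m * B" using am_hi \<open>m < B\<close> unfolding mult_Suc by linarith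
  hence "a * m < B * m" by (simp only: mult.commute)
  hence aB: "a < B" by simp
  have "floor_diff n (B ^ Suc j) > 0" if dig: "n div B ^ j mod B = a" for n j
  proof -
    define x where "x = n mod B ^ j"
    have x: "x < B ^ j" using B0 by (simp add: x_def)
    define n' where "n' = B ^ j * a + x"
    have "n mod B ^ Suc j = n mod (B ^ j * B)" by (simp only: power_Suc2)
    also have "\<dots> = B ^ j * (n div B ^ j mod B) + n mod B ^ j" by (rule mod_mult2_eq)
    finally have "n mod B ^ Suc j = n'" by (simp add: dig n'_def x_def)
    hence "floor_diff n (B ^ Suc j) = floor_diff n' (B ^ Suc j)" using B0 floor_diff_mod[of "B ^ Suc j" n] by simp
    also have "\<dots> = floor_diff v m"
    proof (rule floor_diff_close_above)
      have n'm: "n' * m = B ^ j * (a * m) + x * m" by (simp add: n'_def algebra_simps)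
      have vq: "v * B ^ Suc j = B ^ j * (v * B)" by simp
      have "B ^ j * (v * B) \<le> B ^ j * (a * m)" using am_lo by (rule mult_le_mono2)
      thus "v * B ^ Suc j \<le> n' * m" unfolding n'm vq by linarith
      have "B ^ j * (a * m) \<le> B ^ j * (v * B + m)" using am_hi by (rule mult_le_mono2)
      also have "\<dots> = B ^ j * (v * B) + B ^ j * m" by (rule distrib_left)
      finally have "n' * m \<le> B ^ j * (v * B) + B ^ j * m + x * m" unfolding n'm by simp
      moreover have "x * m \<le> B ^ j * m" using x by simp
      ultimately have "n' * m - v * B ^ Suc j \<le> 2 * (B ^ j * m)" unfolding vq by linarith
      hence "coeff_sum * (n' * m - v * B ^ Suc j) \<le> coeff_sum * (2 * (B ^ j * m))" by (rule mult_le_mono2)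
      also have "\<dots> \<le> k * B ^ j" by (simp add: k_def algebra_simps)
      also have "\<dots> < B * B ^ j" using Bk B0 by (intro mult_less_mono1) auto
      finally show "coeff_sum * (n' * m - v * B ^ Suc j) < B ^ Suc j" by simp
    qed (use B0 pos in auto)
    finally show ?thesis using v(2) by simp
  qed
  thus ?thesis using aB k0 unfolding B_def by blast
qed

text \<open>Digit \<open>a\<close> at position \<open>j\<close> makes the Legendre term for
  \<open>p ^ (k * Suc j)\<close> at least 1. These exponents are distinct for distinct
  \<open>j\<close>, and all other terms are nonnegative.\<close>

lemma digit_count_le_multiplicity:
  assumes p: "prime p" and k: "k > 0"
    and nonneg: "\<And>u m. m > 0 \<Longrightarrow> floor_diff u m \<ge> 0"
    and dig: "\<And>n j. n div (p ^ k) ^ j mod p ^ k = a \<Longrightarrow> floor_diff n ((p ^ k) ^ Suc j) > 0"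
  shows "digit_count (p ^ k) a L n + multiplicity (int p) (\<Prod>j\<in>J. fact (d j * n)) \<le>
         multiplicity (int p) (\<Prod>i\<in>I. fact (c i * n))"
proof -
  \<comment> \<open>The first summand makes room for all exponents \<open>k * Suc j\<close> with
    \<open>j < L\<close>, the second makes the cut-off valid in
    \<open>multiplicity_ratio\<close>.\<close>
  define \<Lambda> where "\<Lambda> = k * L + coeff_sum * n"
  have p1: "p > 1" using p prime_gt_1_nat by blast
  have "coeff_sum * n < p ^ (coeff_sum * n)" using p1 by (intro power_gt_expt) simp
  also have "\<dots> \<le> p ^ Suc \<Lambda>" using p1 by (intro power_increasing) (auto simp: \<Lambda>_def)
  finally have mult: "int (multiplicity (int p) (\<Prod>i\<in>I. fact (c i * n))) -
         int (multiplicity (int p) (\<Prod>j\<in>J. fact (d j * n))) = (\<Sum>l = 1..\<Lambda>. floor_diff n (p ^ l))"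
    by (rule multiplicity_ratio[OF p])
  have "int (digit_count (p ^ k) a L n) = (\<Sum>j<L. of_bool (n div (p ^ k) ^ j mod p ^ k = a))"
    by (simp add: digit_count_def)
  also have "\<dots> \<le> (\<Sum>j<L. floor_diff n (p ^ (k * Suc j)))"
  proof (rule sum_mono)
    fix j
    have "floor_diff n ((p ^ k) ^ Suc j) \<ge> 0" using p1 by (intro nonneg) simp
    thus "of_bool (n div (p ^ k) ^ j mod p ^ k = a) \<le> floor_diff n (p ^ (k * Suc j))"
      using dig[of n j] unfolding power_mult by (auto simp: of_bool_def simp del: power_Suc)
  qed
  also have "\<dots> = (\<Sum>l \<in> (\<lambda>j. k * Suc j) ` {..<L}. floor_diff n (p ^ l))"
    using k by (subst sum.reindex) (auto intro: inj_onI)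
  also have "\<dots> \<le> (\<Sum>l = 1..\<Lambda>. floor_diff n (p ^ l))"
  proof (rule sum_mono2)
    show "(\<lambda>j. k * Suc j) ` {..<L} \<subseteq> {1..\<Lambda>}"
    proof safe
      fix j assume "j < L"
      hence "k * Suc j \<le> k * L" by (intro mult_le_mono2) simp
      thus "k * Suc j \<in> {1..\<Lambda>}" using k by (simp add: \<Lambda>_def)
    qed
  qed (use p1 nonneg in auto)
  finally show ?thesis using mult by linarith
qed

end

section \<open>The exceptional set has density zero\<close>

lemma density_one_of_linear_bounds:
  assumes "\<And>e. e > 0 \<Longrightarrow> \<exists>c. \<forall>N. real (card {n. n < N \<and> \<not> Q n}) \<le> e * real N + c"
  shows "(\<lambda>N. 1 / real N * real (card {n. n < N \<and> Q n})) \<longlonglongrightarrow> 1"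
proof -
  have "(\<lambda>N. 1 - real (card {n. n < N \<and> \<not> Q n}) / real N) \<longlonglongrightarrow> 1 - 0"
    by (intro tendsto_diff tendsto_const density_zero_of_linear_bounds assms)
  moreover have "\<forall>\<^sub>F N in sequentially. 1 - real (card {n. n < N \<and> \<not> Q n}) / real N =
      1 / real N * real (card {n. n < N \<and> Q n})"
  proof (rule eventually_sequentiallyI)
    fix N :: nat assume N: "1 \<le> N"
    have "card {..<N} = card ({n. n < N \<and> Q n} \<union> {n. n < N \<and> \<not> Q n})"
      by (intro arg_cong[where f = card]) auto
    also have "\<dots> = card {n. n < N \<and> Q n} + card {n. n < N \<and> \<not> Q n}"
      by (intro card_Un_disjoint) auto
    finally have "real N = real (card {n. n < N \<and> Q n}) + real (card {n. n < N \<and> \<not> Q n})"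
      by simp
    thus "1 - real (card {n. n < N \<and> \<not> Q n}) / real N = 1 / real N * real (card {n. n < N \<and> Q n})"
      using N by (simp add: field_simps)
  qed
  ultimately show ?thesis by (simp add: tendsto_cong)
qed

theorem theorem2:
  fixes p \<alpha> r s t :: nat
    and P :: "int poly"
    and C D E F :: "nat \<Rightarrow> int"
  assumes "prime p"
    and "\<alpha> > 0"
    and "\<And>i. i \<in> {1..r} \<Longrightarrow> C i > 0"
    and "\<And>i. i \<in> {1..s} \<Longrightarrow> D i > 0"
    and "\<And>i. i \<in> {1..t} \<Longrightarrow> \<not> int p dvd gcd (E i) (F i)"
    and "(\<Sum>i = 1..r. C i) = (\<Sum>i = 1..s. D i)"
    and "C ` {1..r} \<noteq> D ` {1..s}"
    and "\<And>i n. i \<in> {1..t} \<Longrightarrow> E i * int n + F i \<noteq> 0"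
    and "\<And>n. S_seq P r C s D t E F n \<in> \<int>"
  shows "(\<lambda>N. 1 / real N * real (card {n. n < N \<and>
            (\<exists>k :: int. S_seq P r C s D t E F n = of_int k \<and> [k = 0] (mod int p ^ \<alpha>))}))
         \<longlonglongrightarrow> 1"
proof (rule density_one_of_linear_bounds)
  fix e :: real assume e: "e > 0"
  let ?Q = "\<lambda>n. \<exists>k :: int. S_seq P r C s D t E F n = of_int k \<and> [k = 0] (mod int p ^ \<alpha>)"
  define c where "c = (\<lambda>i. nat (C i))"
  define d where "d = (\<lambda>i. nat (D i))"
  define W where "W n = (\<Prod>i = 1..t. E i * int n + F i)" for n
  define X where "X n = (\<Prod>i = 1..r. fact (c i * n) :: int)" for n
  define Y where "Y n = (\<Prod>i = 1..s. fact (d i * n) :: int)" for n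
  have X0: "X n \<noteq> 0" and Y0: "Y n \<noteq> 0" and W0: "W n \<noteq> 0" for n
    using assms(8) by (auto simp: X_def Y_def W_def)
  have C: "C i = int (c i)" if "i \<in> {1..r}" for i using assms(3)[OF that] by (simp add: c_def)
  have D: "D i = int (d i)" if "i \<in> {1..s}" for i using assms(4)[OF that] by (simp add: d_def)
  have S: "S_seq P r C s D t E F n = of_int (poly P (int n) * X n) / of_int (W n * Y n)" for n
  proof -
    have "(\<Prod>i = 1..r. fact (nat (C i * int n))) = (of_int (X n) :: rat)"
      unfolding X_def of_int_prod
      by (intro prod.cong refl) (simp add: C flip: of_nat_mult)
    moreover have "(\<Prod>i = 1..s. fact (nat (D i * int n))) = (of_int (Y n) :: rat)"
      unfolding Y_def of_int_prod
      by (intro prod.cong refl) (simp add: D flip: of_nat_mult)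
    ultimately show ?thesis by (simp add: S_seq_def W_def)
  qed
  have "\<exists>z. S_seq P r C s D t E F n = of_int z \<and> z * W n * Y n = poly P (int n) * X n" for n
  proof -
    obtain z where z: "S_seq P r C s D t E F n = of_int z" using assms(9)[of n] by (auto elim: Ints_cases)
    hence "of_int (poly P (int n) * X n) = (of_int (z * (W n * Y n)) :: rat)"
      using W0[of n] Y0[of n] unfolding S by (simp add: field_simps)
    hence "poly P (int n) * X n = z * (W n * Y n)" by (simp only: of_int_eq_iff)
    thus ?thesis using z by (auto simp: mult_ac)
  qed
  then obtain z where z: "\<And>n. S_seq P r C s D t E F n = of_int (z n)"
    and zeq: "\<And>n. z n * W n * Y n = poly P (int n) * X n" by metis
  have QI: "?Q n" if "int p ^ \<alpha> dvd z n" for n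
    using z[of n] that by (auto simp: cong_0_iff)
  have z0: "z n = 0" if "poly P (int n) = 0" for n
    using zeq[of n] W0[of n] Y0[of n] that by simp
  show "\<exists>c. \<forall>N. real (card {n. n < N \<and> \<not> ?Q n}) \<le> e * real N + c"
  \<comment> \<open>The sign of \<open>g\<close> can be inferred only for nonzero \<open>P\<close>;
    for \<open>P = 0\<close> every \<open>S n\<close> is 0.\<close>
  proof (cases "P = 0")
    case True
    hence "?Q n" for n using z0 by (intro QI) auto
    hence "{n. n < N \<and> \<not> ?Q n} = {}" for N by blast
    hence "real (card {n. n < N \<and> \<not> ?Q n}) \<le> e * real N + 0" for N
      using e by (simp only: card.empty) simp
    thus ?thesis by blast
  next
    case False
    interpret factorial_ratio "{1..r}" c "{1..s}" d
    proof
      have "int (\<Sum>i = 1..r. c i) = int (\<Sum>i = 1..s. d i)"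
        using assms(6) by (simp add: C D)
      thus "(\<Sum>i = 1..r. c i) = (\<Sum>i = 1..s. d i)" by (simp only: of_nat_eq_iff)
    qed (use assms(3,4) in \<open>auto simp: c_def d_def\<close>)
    \<comment> \<open>Forgetting the linear factors \<open>W n\<close> leaves the divisibility that
      \<open>floor_diff_nonneg\<close> asks for.\<close>
    have dvd: "Y n dvd poly P (int n) * X n" for n by (metis zeq dvd_triv_right)
    have nonneg: "floor_diff u m \<ge> 0" if "m > 0" for u m
      using floor_diff_nonneg[OF False dvd[unfolded X_def Y_def] that] .
    have "c ` {1..r} \<noteq> d ` {1..s}"
    proof
      assume "c ` {1..r} = d ` {1..s}"
      hence "int ` c ` {1..r} = int ` d ` {1..s}" by simp
      moreover have "int ` c ` {1..r} = C ` {1..r}" "int ` d ` {1..s} = D ` {1..s}"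
        unfolding image_image using C D by (auto intro!: image_cong)
      ultimately show False using assms(7) by simp
    qed
    then obtain u m where um: "m > 0" "floor_diff u m \<noteq> 0" using floor_diff_not_identically_zero by blast
    hence "floor_diff u m > 0" using nonneg[of m u] by simp
    have p1: "p > 1" using assms(1) prime_gt_1_nat by blast
    obtain k a where ka: "k > 0" "a < p ^ k"
      "\<And>n j. n div (p ^ k) ^ j mod p ^ k = a \<Longrightarrow> floor_diff n ((p ^ k) ^ Suc j) > 0"
      using digit_forces_floor_diff_pos[OF \<open>floor_diff u m > 0\<close> um(1) p1] by blast
    define B where "B = p ^ k"
    have aB: "a < B" using ka(2) by (simp add: B_def)
    \<comment> \<open>Half of \<open>e\<close> is reserved for the linear factors and half for the
      digits. Taking \<open>h = Suc h0\<close> ensures \<open>h > 0\<close>.\<close>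
    obtain h0 where h0: "(1 / real p) ^ h0 < e / (2 * (real t + 1))"
      using real_arch_pow_inv[of "e / (2 * (real t + 1))" "1 / real p"] e p1 by auto
    define h where "h = Suc h0"
    have "(1 / real p) ^ h \<le> (1 / real p) ^ h0" unfolding h_def using p1 by (intro power_decreasing) auto
    hence "(1 / real p) ^ h \<le> e / (2 * (real t + 1))" using h0 by linarith
    hence "(real t + 1) * (1 / real p) ^ h \<le> e / 2" by (simp add: field_simps)
    moreover have "real t * (1 / real p) ^ h \<le> (real t + 1) * (1 / real p) ^ h"
      by (intro mult_right_mono) auto
    ultimately have "real t * (1 / real p) ^ h \<le> e / 2" by linarith
    hence h: "real t / real (p ^ h) \<le> e / 2"
      by (simp only: power_divide power_one of_nat_power times_divide_eq_right mult_1_right)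
    \<comment> \<open>Each of the \<open>t\<close> linear factors may cancel up to \<open>h\<close>
      powers of \<open>p\<close>, and \<alpha> must remain.\<close>
    define K where "K = \<alpha> + t * h"
    \<comment> \<open>The average weight of one digit. The proportion of \<open>n < B ^ L\<close>
      with fewer than \<open>K\<close> digits \<open>a\<close> is at most
      \<open>2 ^ K * \<theta> ^ L\<close>, which a large \<open>L\<close> makes at most
      \<open>e / 2\<close>.\<close>
    define \<theta> where "\<theta> = 1 - 1 / (2 * real B)"
    have \<theta>: "0 < \<theta>" "\<theta> < 1" "real B - 1 / 2 = real B * \<theta>"
      using aB by (auto simp: \<theta>_def field_simps)
    obtain L where L: "\<theta> ^ L < e / 2 / 2 ^ K"
      using real_arch_pow_inv[of "e / 2 / 2 ^ K" \<theta>] e \<theta> by auto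
    define Z where "Z = {n. n < B ^ L \<and> digit_count B a L n < K}"
    have "real (card Z) \<le> 2 ^ K * (real B * \<theta>) ^ L"
      using card_digit_count_less[OF aB] \<theta>(3) by (simp add: Z_def)
    also have "\<dots> = real (B ^ L) * (2 ^ K * \<theta> ^ L)" by (simp add: power_mult_distrib)
    also have "\<dots> \<le> real (B ^ L) * (e / 2)"
      using L by (intro mult_left_mono) (auto simp: field_simps)
    finally have Z: "real (card Z) / real (B ^ L) \<le> e / 2"
      using aB by (simp add: divide_le_eq mult.commute)
    let ?A = "\<lambda>N i. {n. n < N \<and> int p ^ h dvd E i * int n + F i}"
    let ?R = "\<lambda>N. {n. n < N \<and> digit_count B a L n < K}"
    have good: "?Q n" if nd: "\<And>i. i \<in> {1..t} \<Longrightarrow> \<not> int p ^ h dvd E i * int n + F i"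
      and dc: "digit_count B a L n \<ge> K" for n
    proof (rule QI, cases "poly P (int n) = 0")
      \<comment> \<open>Zero is treated apart because \<open>multiplicity\<close> has the default
        value 0 there.\<close>
      case Pn: False
      have pe: "prime_elem (int p)" using assms(1) by simp
      let ?v = "multiplicity (int p)"
      have "?v (W n) = (\<Sum>i = 1..t. ?v (E i * int n + F i))"
        unfolding W_def using assms(8)
        by (intro prime_elem_multiplicity_prod_distrib[OF pe]) auto
      also have "\<dots> \<le> (\<Sum>i = 1..t. h)"
      proof (rule sum_mono)
        fix i assume "i \<in> {1..t}"
        thus "?v (E i * int n + F i) \<le> h"
          using nd[of i] multiplicity_dvd'[of h "int p" "E i * int n + F i"] by fastforce
      qed
      finally have vW: "?v (W n) \<le> t * h" by simp
      have zn: "z n \<noteq> 0" using zeq[of n] Pn X0[of n] by auto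
      have "?v (z n) + ?v (W n) + ?v (Y n) = ?v (z n * W n * Y n)"
        using zn W0 Y0 by (simp add: prime_elem_multiplicity_mult_distrib[OF pe])
      also have "\<dots> = ?v (poly P (int n)) + ?v (X n)"
        unfolding zeq using Pn X0 by (simp add: prime_elem_multiplicity_mult_distrib[OF pe])
      finally have "?v (z n) + ?v (W n) + ?v (Y n) \<ge> ?v (X n)" by simp
      moreover have "digit_count B a L n + ?v (Y n) \<le> ?v (X n)"
        unfolding B_def X_def Y_def
        by (rule digit_count_le_multiplicity[OF assms(1) ka(1) nonneg ka(3)])
      ultimately have "\<alpha> \<le> ?v (z n)" using dc vW unfolding K_def by linarith
      thus "int p ^ \<alpha> dvd z n" by (rule multiplicity_dvd')
    qed (simp add: z0)
    \<comment> \<open>The constant comes from the last incomplete period: one \<open>n\<close> for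
      each linear factor, and \<open>card Z\<close> for the digit condition.\<close>
    have "real (card {n. n < N \<and> \<not> ?Q n}) \<le> e * real N + (real t + real (card Z))" for N
    proof -
      have "{n. n < N \<and> \<not> ?Q n} \<subseteq> (\<Union>i\<in>{1..t}. ?A N i) \<union> ?R N"
        using good not_less by blast
      hence "card {n. n < N \<and> \<not> ?Q n} \<le> card ((\<Union>i\<in>{1..t}. ?A N i) \<union> ?R N)"
        by (intro card_mono) auto
      also have "\<dots> \<le> card (\<Union>i\<in>{1..t}. ?A N i) + card (?R N)" by (rule card_Un_le)
      also have "card (\<Union>i\<in>{1..t}. ?A N i) \<le> (\<Sum>i\<in>{1..t}. card (?A N i))"
        by (rule card_UN_le) simp
      also have "\<dots> \<le> (\<Sum>i\<in>{1..t}. N div p ^ h + 1)"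
        using assms(1,5) by (intro sum_mono card_dvd_linear_le) (auto simp: h_def)
      also have "card (?R N) \<le> (N div B ^ L + 1) * card Z"
        unfolding Z_def using aB by (intro card_periodic_le) (auto simp: digit_count_mod)
      finally have "card {n. n < N \<and> \<not> ?Q n} \<le> t * (N div p ^ h + 1) + (N div B ^ L + 1) * card Z"
        by simp
      hence "real (card {n. n < N \<and> \<not> ?Q n}) \<le>
          real (t * (N div p ^ h + 1) + (N div B ^ L + 1) * card Z)" by (simp only: of_nat_le_iff)
      also have "\<dots> = real t * (real (N div p ^ h) + 1) + (real (N div B ^ L) + 1) * real (card Z)"
        by (simp add: algebra_simps)
      also have "\<dots> \<le> real t * (real N / real (p ^ h) + 1) + (real N / real (B ^ L) + 1) * real (card Z)"
        by (intro add_mono mult_left_mono mult_right_mono of_nat_div_le_of_nat order_refl) auto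
      also have "\<dots> = real t / real (p ^ h) * real N + real (card Z) / real (B ^ L) * real N
          + (real t + real (card Z))"
        by (simp add: algebra_simps)
      also have "\<dots> \<le> e / 2 * real N + e / 2 * real N + (real t + real (card Z))"
        using h Z by (intro add_mono mult_right_mono) auto
      finally show ?thesis by simp
    qed
    thus ?thesis by blast
  qed
qed

end
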